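(* Let $p\geq 2$ and let $h\in C^2(\mathbb{R}^n)$ be nonnegative, positively homogeneous of degree $p$, with $\lambda|v|^2\leq\langle D^2h(x)v,v\rangle\leq\Lambda|v|^2$ for all $x\in S^{n-1}$, $v\in\mathbb{R}^n$, for some constants $0<\lambda\le\Lambda$. If $T$ is an $h$-monotone map with $T\in L^{p-1}_{\mathrm{loc}}(\mathbb{R}^n)$, then for almost every $x_0\in\mathbb{R}^n$ $$\sup_{x\in B_R(x_0)}|Tx-Tx_0|=O\left(R^{1/(p-1)}\right)\quad\text{as }R\to0,$$ that is, $T\in T^{1/(p-1),\infty}(x_0)$ for a.e. $x_0$.
   Context: A multivalued map $T:\mathbb{R}^n\to\mathcal P(\mathbb{R}^n)$ is $h$-monotone if $h(x-\xi)+h(y-\zeta)\leq h(x-\zeta)+h(y-\xi)$ for all $x,y$ with $T(x),T(y)\neq\emptyset$ and all $\xi\in T(x)$, $\zeta\in T(y)$; such maps are single-valued a.e. and are regarded as a.e. defined functions $\mathbb{R}^n\to\mathbb{R}^n$. The supremum is an essential supremum. For real $k$, $f\in T^{k,\infty}(x_0)$ means there is a polynomial $P_{x_0}$ of degree strictly less than $k$ with $\operatorname{ess\,sup}_{B_r(x_0)}|f-P_{x_0}|=O(r^k)$ as $r\to0$. *)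

theory Defs
  imports "HOL-Analysis.Analysis"
begin

definition h_monotone :: "('a::real_normed_vector \<Rightarrow> real) \<Rightarrow> ('a \<Rightarrow> 'a set) \<Rightarrow> bool" where
  "h_monotone h T \<longleftrightarrow>
     (\<forall>x y \<xi> \<zeta>. T x \<noteq> {} \<longrightarrow> T y \<noteq> {} \<longrightarrow> \<xi> \<in> T x \<longrightarrow> \<zeta> \<in> T y \<longrightarrow>
        h (x - \<xi>) + h (y - \<zeta>) \<le> h (x - \<zeta>) + h (y - \<xi>))"

definition locally_Lq :: "real \<Rightarrow> ('a::euclidean_space \<Rightarrow> 'b::real_normed_vector) \<Rightarrow> bool" where
  "locally_Lq q f \<longleftrightarrow> f \<in> borel_measurable lebesgue \<and>
     (\<forall>K. compact K \<longrightarrow> set_integrable lebesgue K (\<lambda>x. norm (f x) powr q))"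

end

theory Submission
  imports Defs
begin

text \<open>
  The optimality inequality and the bound on the Hessian make \<open>S x = 2C x - G (x - T x)\<close> monotone
  wherever \<open>T\<close> is bounded, and \<open>T\<close> is locally bounded because \<open>G w \<bullet> w\<close> dominates \<open>\<bar>w\<bar>\<^sup>p\<close>. A monotone
  map is pointwise Lipschitz almost everywhere. As \<open>G\<close> is uniformly monotone,
  \<open>\<bar>G a - G b\<bar> \<ge> c \<bar>a - b\<bar>\<^bsup>p-1\<^esup>\<close>, the Lipschitz bound for \<open>S\<close> becomes a bound of order \<open>1/(p-1)\<close> for \<open>T\<close>.

  The Lipschitz property of \<open>S\<close> is obtained without Rademacher's theorem. By Kirszbraun's argument
  the resolvent \<open>g = (id + S)\<^sup>-\<^sup>1\<close> extends to the whole space and is firmly nonexpansive. If \<open>S\<close> has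
  a steep secant at \<open>x0\<close>, then \<open>g\<close> maps a long segment to a small neighbourhood of \<open>x0\<close>, and being
  nonexpansive it does the same with a tube around that segment. So the pushforward of Lebesgue measure
  under \<open>g\<close> has infinite upper density at \<open>x0\<close>. It is locally finite, hence by Vitali's covering
  theorem such points form a null set.
\<close>

subsection \<open>Kirszbraun's lemma and Minty's theorem\<close>

text \<open>After translation by \<open>c\<close> the cross terms of the double sum collapse because
  the weights add up to 1. The centre is left free because \<open>kirszbraun_finite\<close> takes 0
  for the images and \<open>z\<close> for the sources.\<close>

lemma weighted_variance:
  fixes v :: "'i \<Rightarrow> 'a::real_inner" and t :: "'i \<Rightarrow> real"
  assumes "finite F" and t1: "sum t F = 1"
  shows "(\<Sum>i\<in>F. \<Sum>j\<in>F. t i * t j * (norm (v i - v j))\<^sup>2)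
    = 2 * (\<Sum>i\<in>F. t i * (norm (v i - c))\<^sup>2) - 2 * (norm ((\<Sum>i\<in>F. t i *\<^sub>R v i) - c))\<^sup>2"
proof -
  define w where "w i = v i - c" for i
  have s: "(\<Sum>i\<in>F. t i *\<^sub>R v i) - c = (\<Sum>i\<in>F. t i *\<^sub>R w i)"
    by (simp add: w_def scaleR_diff_right sum_subtractf flip: scaleR_sum_left) (simp add: t1)
  have "(\<Sum>i\<in>F. \<Sum>j\<in>F. t i * t j * (norm (v i - v j))\<^sup>2)
      = (\<Sum>i\<in>F. \<Sum>j\<in>F. t j * (t i * (norm (w i))\<^sup>2) + t i * (t j * (norm (w j))\<^sup>2)
                     - 2 * ((t i *\<^sub>R w i) \<bullet> (t j *\<^sub>R w j)))"
    by (intro sum.cong refl)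
      (simp add: w_def power2_norm_eq_inner inner_diff_left inner_diff_right inner_commute algebra_simps)
  also have "\<dots> = (\<Sum>i\<in>F. \<Sum>j\<in>F. t j * (t i * (norm (w i))\<^sup>2))
       + (\<Sum>i\<in>F. \<Sum>j\<in>F. t i * (t j * (norm (w j))\<^sup>2))
       - 2 * (\<Sum>i\<in>F. \<Sum>j\<in>F. (t i *\<^sub>R w i) \<bullet> (t j *\<^sub>R w j))"
    by (simp only: sum.distrib sum_subtractf sum_distrib_left)
  also have "(\<Sum>i\<in>F. \<Sum>j\<in>F. t j * (t i * (norm (w i))\<^sup>2)) = (\<Sum>i\<in>F. t i * (norm (w i))\<^sup>2)"
    by (simp add: t1 flip: sum_distrib_right)
  also have "(\<Sum>i\<in>F. \<Sum>j\<in>F. t i * (t j * (norm (w j))\<^sup>2)) = (\<Sum>i\<in>F. t i * (norm (w i))\<^sup>2)"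
    by (simp add: t1 flip: sum_distrib_left sum_distrib_right)
  also have "(\<Sum>i\<in>F. \<Sum>j\<in>F. (t i *\<^sub>R w i) \<bullet> (t j *\<^sub>R w j)) = (norm (\<Sum>i\<in>F. t i *\<^sub>R w i))\<^sup>2"
    by (simp only: power2_norm_eq_inner inner_sum_left inner_sum_right) (rule sum.swap)
  finally show ?thesis by (simp add: s w_def)
qed

text \<open>With \<open>t\<close> a maximizer over the simplex of
  \<open>\<Sum>i. t i * (\<bar>u - u i\<bar>\<^sup>2 - \<bar>z - z i\<bar>\<^sup>2)\<close>, where \<open>u = (\<Sum>i. t i * u i)\<close>, the maximum is nonpositive by
  \<open>weighted_variance\<close>, and its first order condition says that \<open>u\<close> is the required point.\<close>

lemma kirszbraun_finite:
  fixes F :: "('a::euclidean_space \<times> 'a) set"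
  assumes fin: "finite F"
    and lip: "\<And>p q. \<lbrakk>p \<in> F; q \<in> F\<rbrakk> \<Longrightarrow> norm (fst p - fst q) \<le> norm (snd p - snd q)"
  shows "\<exists>u. \<forall>p\<in>F. norm (u - fst p) \<le> norm (z - snd p)"
proof (cases "F = {}")
  case False
  \<comment> \<open>The third coordinate makes the objective a function \<open>\<phi>\<close> of the
    point of the hull alone, affine minus a squared norm, so compactness of the hull yields the
    maximizer.\<close>
  define V where "V = (\<lambda>p. (fst p, snd p, (norm (fst p))\<^sup>2 - (norm (snd p - z))\<^sup>2)) ` F"
  have finV: "finite V" and neV: "V \<noteq> {}" using fin False by (auto simp: V_def)
  define \<phi> :: "'a \<times> 'a \<times> real \<Rightarrow> real" where "\<phi> q = snd (snd q) - (norm (fst q))\<^sup>2" for q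
  have "compact (convex hull V)"
    by (simp add: finV finite_imp_compact_convex_hull)
  moreover have "continuous_on (convex hull V) \<phi>"
    unfolding \<phi>_def by (intro continuous_intros)
  ultimately obtain q where q: "q \<in> convex hull V"
    and qmax: "\<And>r. r \<in> convex hull V \<Longrightarrow> \<phi> r \<le> \<phi> q"
    using continuous_attains_sup[of "convex hull V" \<phi>] neV by auto
  obtain t where t0: "\<And>x. x \<in> V \<Longrightarrow> 0 \<le> t x" and t1: "sum t V = 1"
    and tq: "(\<Sum>x\<in>V. t x *\<^sub>R x) = q"
    using q unfolding convex_hull_finite[OF finV] by auto
  have f: "fst q = (\<Sum>x\<in>V. t x *\<^sub>R fst x)"
    and a: "snd (snd q) = (\<Sum>x\<in>V. t x * snd (snd x))"
    unfolding tq[symmetric] by (simp_all add: fst_sum snd_sum)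
  have a': "(\<Sum>x\<in>V. t x * snd (snd x))
     = (\<Sum>x\<in>V. t x * (norm (fst x))\<^sup>2) - (\<Sum>x\<in>V. t x * (norm (fst (snd x) - z))\<^sup>2)"
    unfolding sum_subtractf[symmetric]
    by (intro sum.cong) (auto simp: V_def algebra_simps)
  have lipV: "norm (fst x - fst y) \<le> norm (fst (snd x) - fst (snd y))" if "x \<in> V" "y \<in> V" for x y
    using that unfolding V_def by (elim imageE) (simp add: lip)
  have "(\<Sum>x\<in>V. \<Sum>y\<in>V. t x * t y * (norm (fst x - fst y))\<^sup>2)
     \<le> (\<Sum>x\<in>V. \<Sum>y\<in>V. t x * t y * (norm (fst (snd x) - fst (snd y)))\<^sup>2)"
    by (intro sum_mono mult_left_mono power_mono mult_nonneg_nonneg t0 lipV norm_ge_zero)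
  \<comment> \<open>By \<open>weighted_variance\<close> the comparison of the pair sums says that
    \<open>\<phi> q\<close> is at most minus the squared distance from \<open>z\<close> to the
    barycentre of the sources.\<close>
  then have "\<phi> q \<le> 0"
    unfolding weighted_variance[OF finV t1, of fst 0] weighted_variance[OF finV t1, of "\<lambda>x. fst (snd x)" z]
    unfolding \<phi>_def f a a' by simp (smt (verit) zero_le_power2)
  have "norm (fst q - fst p) \<le> norm (z - snd p)" if p: "p \<in> F" for p
  proof -
    define x where "x = (fst p, snd p, (norm (fst p))\<^sup>2 - (norm (snd p - z))\<^sup>2)"
    have x: "x \<in> V" using p by (auto simp: x_def V_def)
    \<comment> \<open>Moving from \<open>q\<close> towards \<open>x\<close> by \<open>s\<close>
      changes \<open>\<phi>\<close> by exactly \<open>s * (A - s * B)\<close>, so maximality forces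
      the slope \<open>A\<close> to be nonpositive.\<close>
    define A where "A = snd (snd x) - snd (snd q) - 2 * (fst q \<bullet> (fst x - fst q))"
    define B where "B = (norm (fst x - fst q))\<^sup>2"
    have ineq: "A \<le> s * B" if s: "0 < s" "s < 1" for s
    proof -
      have "(1 - s) *\<^sub>R q + s *\<^sub>R x \<in> convex hull V"
        using s by (intro convexD_alt convex_convex_hull q hull_inc x) auto
      from qmax[OF this] have "\<phi> ((1 - s) *\<^sub>R q + s *\<^sub>R x) \<le> \<phi> q" .
      moreover have "\<phi> ((1 - s) *\<^sub>R q + s *\<^sub>R x) = \<phi> q + s * (A - s * B)"
        unfolding \<phi>_def A_def B_def
        by (simp add: power2_norm_eq_inner inner_simps inner_commute algebra_simps)
      ultimately show ?thesis using s by (simp add: mult_le_0_iff)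
    qed
    have "A \<le> 0"
    proof (rule field_le_epsilon)
      fix e :: real assume "e > 0"
      define s where "s = min (1/2) (e / (B + 1))"
      have B: "B \<ge> 0" by (simp add: B_def)
      have s: "0 < s" "s < 1" using \<open>e > 0\<close> B by (auto simp: s_def)
      have "s * B \<le> (e / (B + 1)) * B" using B by (intro mult_right_mono) (auto simp: s_def)
      also have "\<dots> \<le> e" using B \<open>e > 0\<close> by (simp add: field_simps)
      finally show "A \<le> 0 + e" using ineq[OF s] by simp
    qed
    then have "(norm (fst q - fst p))\<^sup>2 - (norm (snd p - z))\<^sup>2 \<le> \<phi> q"
      unfolding A_def \<phi>_def x_def
      by (simp add: power2_norm_eq_inner inner_simps inner_commute algebra_simps)
    then have "(norm (fst q - fst p))\<^sup>2 \<le> (norm (z - snd p))\<^sup>2"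
      using \<open>\<phi> q \<le> 0\<close> unfolding norm_minus_commute[of z] by linarith
    then show ?thesis by (rule power2_le_imp_le) simp
  qed
  then show ?thesis by blast
qed simp

text \<open>Closed balls are compact, so the finite case supplies the finite intersection property
  for the whole family.\<close>

lemma kirszbraun_point:
  fixes u v :: "'i \<Rightarrow> 'a::euclidean_space"
  assumes lip: "\<And>i j. \<lbrakk>i \<in> D; j \<in> D\<rbrakk> \<Longrightarrow> norm (u i - u j) \<le> norm (v i - v j)"
  shows "\<exists>w. \<forall>i\<in>D. norm (w - u i) \<le> norm (z - v i)"
proof -
  have "\<Inter>((\<lambda>i. cball (u i) (norm (z - v i))) ` D) \<noteq> {}"
  proof (rule compact_fip_Heine_Borel)
    fix \<F> assume "finite \<F>" "\<F> \<subseteq> (\<lambda>i. cball (u i) (norm (z - v i))) ` D"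
    then obtain E where E: "E \<subseteq> D" "finite E" "\<F> = (\<lambda>i. cball (u i) (norm (z - v i))) ` E"
      by (meson finite_subset_image)
    have "\<exists>w. \<forall>p\<in>(\<lambda>i. (u i, v i)) ` E. norm (w - fst p) \<le> norm (z - snd p)"
      using E by (intro kirszbraun_finite) (auto intro!: lip)
    then obtain w where "\<And>i. i \<in> E \<Longrightarrow> norm (w - u i) \<le> norm (z - v i)" by auto
    then have "w \<in> \<Inter>\<F>" by (auto simp: E(3) dist_norm norm_minus_commute[of _ w])
    then show "\<Inter>\<F> \<noteq> {}" by blast
  qed auto
  then obtain w where w: "w \<in> \<Inter>((\<lambda>i. cball (u i) (norm (z - v i))) ` D)" by blast
  have "norm (w - u i) \<le> norm (z - v i)" if "i \<in> D" for i
    using w that by (auto simp: dist_norm norm_minus_commute[of w])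
  then show ?thesis by blast
qed

text \<open>Cayley transform: monotonicity of \<open>S\<close> makes \<open>x + S x\<close> to
  \<open>x - S x\<close> nonexpansive. Kirszbraun extends this map to \<open>z\<close> with some
  value \<open>w\<close>, and transforming back gives \<open>x = (w + z) / 2\<close>, the value at
  \<open>z\<close> of the extended resolvent.\<close>

lemma monotone_minty:
  fixes S :: "'a::euclidean_space \<Rightarrow> 'a"
  assumes mono: "\<And>x y. \<lbrakk>x \<in> D; y \<in> D\<rbrakk> \<Longrightarrow> 0 \<le> (S x - S y) \<bullet> (x - y)"
  shows "\<exists>x. \<forall>y\<in>D. 0 \<le> ((z - x) - S y) \<bullet> (x - y)"
proof -
  have par: "(norm (a - b))\<^sup>2 + 4 * (a \<bullet> b) = (norm (a + b))\<^sup>2" for a b :: 'a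
    by (simp add: power2_norm_eq_inner inner_simps inner_commute algebra_simps)
  have "norm ((x - S x) - (y - S y)) \<le> norm ((x + S x) - (y + S y))" if "x \<in> D" "y \<in> D" for x y
  proof -
    have e: "(x - S x) - (y - S y) = (x - y) - (S x - S y)"
      "(x + S x) - (y + S y) = (x - y) + (S x - S y)"
      by (simp_all add: algebra_simps)
    have "(norm ((x - S x) - (y - S y)))\<^sup>2 \<le> (norm ((x + S x) - (y + S y)))\<^sup>2"
      using par[of "x - y" "S x - S y"] mono[OF that] unfolding e by (simp only: inner_commute[of "S x - S y"])
    then show ?thesis by (rule power2_le_imp_le) simp
  qed
  then have "\<exists>w. \<forall>y\<in>D. norm (w - (y - S y)) \<le> norm (z - (y + S y))"
    by (rule kirszbraun_point)
  then obtain w where w: "\<And>y. y \<in> D \<Longrightarrow> norm (w - (y - S y)) \<le> norm (z - (y + S y))" by blast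
  define x where "x = (1/2) *\<^sub>R (w + z)"
  have "0 \<le> ((z - x) - S y) \<bullet> (x - y)" if "y \<in> D" for y
  proof -
    have w': "w = 2 *\<^sub>R x - z" by (simp add: x_def)
    have e: "w - (y - S y) = (x - y) - ((z - x) - S y)" "z - (y + S y) = (x - y) + ((z - x) - S y)"
      by (simp_all add: w' algebra_simps scaleR_2)
    have "(norm (w - (y - S y)))\<^sup>2 \<le> (norm (z - (y + S y)))\<^sup>2"
      using w[OF that] by (intro power_mono) auto
    then show ?thesis
      using par[of "x - y" "(z - x) - S y"] unfolding e by (simp only: inner_commute[of "x - y"])
  qed
  then show ?thesis by blast
qed

subsection \<open>Pointwise Lipschitz continuity of monotone maps\<close>

text \<open>The hypothesis says that the pushforward of Lebesgue measure on \<open>V\<close> under \<open>g\<close> has infinite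
  upper density at the points of \<open>N\<close>; phrasing it with sets \<open>W\<close> avoids measurability of \<open>g\<close>.\<close>

lemma vitali_negligible:
  fixes N :: "'a::euclidean_space set" and g :: "'b::euclidean_space \<Rightarrow> 'a"
  assumes V: "V \<in> lmeasurable"
    and fine: "\<And>x m d. \<lbrakk>x \<in> N; 0 < m; 0 < d\<rbrakk> \<Longrightarrow> \<exists>s W. 0 < s \<and> s < d \<and> W \<in> lmeasurable \<and> W \<subseteq> V \<and>
      g ` W \<subseteq> cball x s \<and> m * measure lebesgue (cball x s) \<le> measure lebesgue W"
  shows "negligible N"
  unfolding negligible_outer_le
proof (intro allI impI)
  fix e :: real assume e: "e > 0"
  \<comment> \<open>Chosen so that the measure of \<open>V\<close> divided by \<open>m\<close> is at
    most \<open>e\<close>; the summand 1 keeps \<open>m\<close> positive even if \<open>V\<close> is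
    null.\<close>
  define m where "m = (measure lebesgue V + 1) / e"
  have m: "m > 0" using e by (auto simp: m_def intro!: divide_pos_pos add_nonneg_pos)
  define I where "I = {(x, s, W). 0 < s \<and> W \<in> lmeasurable \<and> W \<subseteq> V \<and>
      g ` W \<subseteq> cball x s \<and> m * measure lebesgue (cball x s) \<le> measure lebesgue W}"
  define B where "B i = cball (fst i) (fst (snd i))" for i :: "'a \<times> real \<times> 'b set"
  have pos: "\<And>i. i \<in> I \<Longrightarrow> 0 < fst (snd i)" by (auto simp: I_def)
  have fine': "\<exists>i. i \<in> I \<and> x \<in> cball (fst i) (fst (snd i)) \<and> fst (snd i) < d" if xd: "x \<in> N" "0 < d" for x d
  proof -
    obtain s W where "0 < s" "s < d" "W \<in> lmeasurable" "W \<subseteq> V"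
      "g ` W \<subseteq> cball x s" "m * measure lebesgue (cball x s) \<le> measure lebesgue W"
      using fine[OF xd(1) m xd(2)] by blast
    then show ?thesis by (intro exI[of _ "(x, s, W)"]) (auto simp: I_def)
  qed
  obtain C where C: "countable C" "C \<subseteq> I" and pw: "pairwise (\<lambda>i j. disjnt (B i) (B j)) C"
    and neg: "negligible (N - (\<Union>i\<in>C. B i))"
    unfolding B_def by (rule Vitali_covering_theorem_cballs[of I "\<lambda>i. fst (snd i)" N fst, OF pos fine']) auto
  have bound: "measure lebesgue (\<Union>i\<in>J. B i) \<le> e" if J: "J \<subseteq> C" "finite J" for J
  proof -
    define W where "W i = snd (snd i)" for i :: "'a \<times> real \<times> 'b set"
    have W: "W i \<in> lmeasurable" "W i \<subseteq> V" "g ` W i \<subseteq> B i"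
      "m * measure lebesgue (B i) \<le> measure lebesgue (W i)" if "i \<in> J" for i
    proof -
      have "i \<in> I" using that C J by auto
      then show "W i \<in> lmeasurable" "W i \<subseteq> V" "g ` W i \<subseteq> B i"
        "m * measure lebesgue (B i) \<le> measure lebesgue (W i)"
        by (auto simp: I_def W_def B_def image_subset_iff)
    qed
    \<comment> \<open>\<open>g\<close> maps \<open>W i\<close> into \<open>B i\<close>, so
      disjointness of the balls passes to the sets \<open>W i\<close>, whose total measure is then
      at most that of \<open>V\<close>.\<close>
    have "pairwise (\<lambda>i j. disjnt (W i) (W j)) J"
      using pw J W(3) unfolding pairwise_def disjnt_iff by (metis image_subset_iff subsetD)
    then have "(\<Sum>i\<in>J. measure lebesgue (W i)) = measure lebesgue (\<Union>i\<in>J. W i)"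
      using measure_UNION'[of J W lebesgue] J W(1) by simp
    also have "\<dots> \<le> measure lebesgue V"
    proof (rule measure_mono_fmeasurable[OF _ _ V])
      show "(\<Union>i\<in>J. W i) \<subseteq> V" using W(2) by (rule UN_least)
      show "(\<Union>i\<in>J. W i) \<in> sets lebesgue"
        using J(2) W(1) by (intro sets.finite_UN fmeasurableD)
    qed
    finally have "(\<Sum>i\<in>J. m * measure lebesgue (B i)) \<le> measure lebesgue V"
      using sum_mono[of J "\<lambda>i. m * measure lebesgue (B i)" "\<lambda>i. measure lebesgue (W i)"] W(4) by simp
    then have "m * (\<Sum>i\<in>J. measure lebesgue (B i)) \<le> measure lebesgue V"
      by (simp add: sum_distrib_left)
    then have "(\<Sum>i\<in>J. measure lebesgue (B i)) \<le> measure lebesgue V / m"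
      using m by (simp add: field_simps)
    also have "\<dots> \<le> e"
      using e m by (simp add: m_def field_simps) 
    finally show ?thesis
      using measure_UNION_le[of J B lebesgue] J by (simp add: B_def)
  qed
  have Bm: "B i \<in> lmeasurable" for i by (simp add: B_def)
  show "\<exists>T. N \<subseteq> T \<and> T \<in> lmeasurable \<and> measure lebesgue T \<le> e"
  proof (intro exI[of _ "(\<Union>i\<in>C. B i) \<union> (N - (\<Union>i\<in>C. B i))"] conjI)
    have U: "(\<Union>i\<in>C. B i) \<in> lmeasurable"
      by (rule fmeasurable_UN_bound[OF C(1) Bm bound])
    then show "(\<Union>i\<in>C. B i) \<union> (N - (\<Union>i\<in>C. B i)) \<in> lmeasurable"
      by (rule fmeasurable.Un[OF _ negligible_imp_measurable[OF neg]])
    have "measure lebesgue ((\<Union>i\<in>C. B i) \<union> (N - (\<Union>i\<in>C. B i)))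
       \<le> measure lebesgue (\<Union>i\<in>C. B i) + measure lebesgue (N - (\<Union>i\<in>C. B i))"
      by (rule measure_Un_le[OF fmeasurableD[OF U] negligible_imp_sets[OF neg]])
    then show "measure lebesgue ((\<Union>i\<in>C. B i) \<union> (N - (\<Union>i\<in>C. B i))) \<le> e"
      using measure_UN_bound[OF C(1) Bm bound] negligible_imp_measure0[OF neg] by linarith
  qed auto
qed


text \<open>\<open>D\<close> stands for the points where \<open>S\<close> is known, and
  \<open>U\<close> for an open region in which \<open>D\<close> is dense; boundedness lets limits of
  \<open>S\<close> stand in at the remaining points of \<open>U\<close>.\<close>

locale bounded_monotone_dense =
  fixes S :: "'a::euclidean_space \<Rightarrow> 'a" and D U :: "'a set" and K :: real
  assumes open_U: "open U" and D_sub: "D \<subseteq> U" and dense: "U \<subseteq> closure D"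
    and mono: "\<And>x y. \<lbrakk>x \<in> D; y \<in> D\<rbrakk> \<Longrightarrow> 0 \<le> (S x - S y) \<bullet> (x - y)"
    and S_bound: "\<And>x. x \<in> D \<Longrightarrow> norm (S x) \<le> K"
begin

text \<open>The pairs monotonically related to the graph of \<open>S\<close>. By
  \<open>related_mono\<close> they are monotone among themselves as soon as one base point lies in
  \<open>U\<close>.\<close>

definition related :: "'a \<Rightarrow> 'a \<Rightarrow> bool" where
  "related x \<xi> \<longleftrightarrow> (\<forall>y\<in>D. 0 \<le> (\<xi> - S y) \<bullet> (x - y))"

lemma related_self: "x \<in> D \<Longrightarrow> related x (S x)"
  by (simp add: related_def mono)

text \<open>A cluster value of \<open>S\<close> along points of \<open>D\<close> tending to
  \<open>y\<close> inherits the inequalities. Every point of \<open>U\<close> can thus be used for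
  comparison.\<close>

lemma related_limit:
  assumes "y \<in> U"
  obtains \<eta> where "norm \<eta> \<le> K" "\<And>x \<xi>. related x \<xi> \<Longrightarrow> 0 \<le> (\<xi> - \<eta>) \<bullet> (x - y)"
proof -
  obtain d where d: "\<And>n. d n \<in> D" "d \<longlonglongrightarrow> y"
    using assms dense closure_sequential by blast
  have "compact (cball (0::'a) K)" by simp
  moreover have "\<forall>n. S (d n) \<in> cball 0 K" using d S_bound by simp
  ultimately obtain \<eta> r where \<eta>: "\<eta> \<in> cball 0 K" "strict_mono r" "((\<lambda>n. S (d n)) \<circ> r) \<longlonglongrightarrow> \<eta>"
    unfolding compact_def by metis
  have dr: "(\<lambda>n. d (r n)) \<longlonglongrightarrow> y"
    using LIMSEQ_subseq_LIMSEQ[OF d(2) \<eta>(2)] by (simp add: o_def)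
  have "0 \<le> (\<xi> - \<eta>) \<bullet> (x - y)" if "related x \<xi>" for x \<xi>
  proof (rule LIMSEQ_le_const)
    show "(\<lambda>n. (\<xi> - S (d (r n))) \<bullet> (x - d (r n))) \<longlonglongrightarrow> (\<xi> - \<eta>) \<bullet> (x - y)"
      using \<eta>(3) dr by (intro tendsto_intros) (auto simp: o_def)
    show "\<exists>N. \<forall>n\<ge>N. 0 \<le> (\<xi> - S (d (r n))) \<bullet> (x - d (r n))"
      using that d(1) by (auto simp: related_def)
  qed
  with \<eta>(1) that show thesis by auto
qed

text \<open>Both pairs are compared with a limit value at a point of \<open>U\<close> strictly
  between \<open>x'\<close> and \<open>x\<close>. The two inequalities have opposite directions
  along \<open>v\<close> and add up to the claim.\<close>

lemma related_mono:
  assumes "related x \<xi>" "related x' \<xi>'" "x' \<in> U"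
  shows "0 \<le> (\<xi> - \<xi>') \<bullet> (x - x')"
proof -
  define v where "v = x - x'"
  obtain e where e: "e > 0" "ball x' e \<subseteq> U"
    using open_U assms(3) openE by blast
  define t where "t = min (1/2) (e / (2 * (norm v + 1)))"
  have nv: "norm v + 1 > 0" by (simp add: add_nonneg_pos)
  have t: "0 < t" "t < 1" using e nv by (auto simp: t_def)
  have "t * norm v \<le> e / (2 * (norm v + 1)) * norm v"
    by (intro mult_right_mono) (auto simp: t_def)
  also have "\<dots> < e" using e nv by (simp add: field_simps add_nonneg_pos)
  finally have "x' + t *\<^sub>R v \<in> U"
    using e t by (auto simp: dist_norm)
  then obtain \<eta> where \<eta>: "\<And>x \<xi>. related x \<xi> \<Longrightarrow> 0 \<le> (\<xi> - \<eta>) \<bullet> (x - (x' + t *\<^sub>R v))"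
    using related_limit by blast
  have "x - (x' + t *\<^sub>R v) = (1 - t) *\<^sub>R v" by (simp add: v_def algebra_simps)
  then have "0 \<le> (\<xi> - \<eta>) \<bullet> v" using \<eta>[OF assms(1)] t by (simp add: zero_le_mult_iff)
  moreover have "(\<xi>' - \<eta>) \<bullet> v \<le> 0" using \<eta>[OF assms(2)] t by (simp add: mult_le_0_iff)
  ultimately show ?thesis by (simp add: inner_diff_left flip: v_def)
qed

text \<open>Comparison with a point displaced from \<open>x\<close> in the direction of
  \<open>\<xi>\<close> bounds the component of \<open>\<xi>\<close> in that direction, which is its
  norm.\<close>

lemma related_norm_le:
  assumes "related x \<xi>" "x \<in> U"
  shows "norm \<xi> \<le> K"
proof -
  obtain e where e: "e > 0" "ball x e \<subseteq> U"
    using open_U assms(2) openE by blast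
  have "norm (sgn \<xi>) \<le> 1" by (simp add: norm_sgn)
  then have "e / 2 * norm (sgn \<xi>) < e" using e mult_left_le[of "norm (sgn \<xi>)" "e / 2"] by linarith
  then have "x + (e / 2) *\<^sub>R sgn \<xi> \<in> U" using e by (auto simp: dist_norm)
  then obtain \<eta> where \<eta>: "norm \<eta> \<le> K"
    "0 \<le> (\<xi> - \<eta>) \<bullet> (x - (x + (e / 2) *\<^sub>R sgn \<xi>))"
    using related_limit assms(1) by metis
  have "\<xi> \<bullet> sgn \<xi> \<le> \<eta> \<bullet> sgn \<xi>"
    using \<eta>(2) e by (simp add: mult_le_0_iff inner_diff_left)
  also have "\<dots> \<le> norm \<eta> * norm (sgn \<xi>)" by (rule norm_cauchy_schwarz)
  also have "\<dots> \<le> K * 1"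
  proof (rule mult_mono[OF \<eta>(1) \<open>norm (sgn \<xi>) \<le> 1\<close>])
    show "0 \<le> K" using \<eta>(1) norm_ge_zero[of \<eta>] by linarith
  qed simp
  finally show ?thesis
    by (cases "\<xi> = 0") (auto simp: sgn_div_norm dot_square_norm power2_eq_square divide_simps split: if_splits)
qed

section \<open>Estimates for the resolvent of a monotone map\<close>

lemma resolvent_firm:
  assumes "related x (z - x)" "related x' (z' - x')" "x' \<in> U"
  shows "(norm (x - x'))\<^sup>2 \<le> (z - z') \<bullet> (x - x')"
  using related_mono[OF assms]
  by (simp add: power2_norm_eq_inner inner_diff_left inner_diff_right inner_commute algebra_simps)

lemma resolvent_nonexpansive:
  assumes "related x (z - x)" "related x' (z' - x')" "x' \<in> U"
  shows "norm (x - x') \<le> norm (z - z')"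
proof -
  have "norm (x - x') * norm (x - x') \<le> norm (z - z') * norm (x - x')"
    using resolvent_firm[OF assms] norm_cauchy_schwarz[of "z - z'" "x - x'"]
    by (simp add: power2_eq_square)
  then show ?thesis
    by (cases "x = x'") auto
qed

text \<open>Firm nonexpansiveness against the two endpoints traps \<open>b\<close> between 0 and
  \<open>c\<close>, apart from the endpoint cases. The geometric mean of the two lengths replaces
  the bound by the length of \<open>z1 - z0\<close> that nonexpansiveness alone would give.\<close>

lemma resolvent_segment:
  assumes "x0 \<in> D" "x1 \<in> D" and t: "0 \<le> t" "t \<le> 1"
    and z0: "z0 = x0 + S x0" and z1: "z1 = x1 + S x1"
    and x: "related x (z0 + t *\<^sub>R (z1 - z0) - x)"
  shows "(norm (x - x0))\<^sup>2 \<le> norm (z1 - z0) * norm (x1 - x0)"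
proof -
  have rel: "related x0 (z0 - x0)" "related x1 (z1 - x1)"
    using assms related_self by auto
  have U: "x0 \<in> U" "x1 \<in> U" using assms D_sub by auto
  define b where "b = (z1 - z0) \<bullet> (x - x0)"
  define c where "c = (z1 - z0) \<bullet> (x1 - x0)"
  have 0: "(norm (x - x0))\<^sup>2 \<le> t * b"
    using resolvent_firm[OF x rel(1) U(1)] by (simp add: b_def)
  have "(norm (x - x1))\<^sup>2 \<le> (z0 + t *\<^sub>R (z1 - z0) - z1) \<bullet> (x - x1)"
    by (rule resolvent_firm[OF x rel(2) U(2)])
  also have "z0 + t *\<^sub>R (z1 - z0) - z1 = (t - 1) *\<^sub>R (z1 - z0)" by (simp add: algebra_simps)
  also have "((t - 1) *\<^sub>R (z1 - z0)) \<bullet> (x - x1) = (t - 1) * (b - c)"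
    unfolding b_def c_def by (simp add: inner_diff_right right_diff_distrib)
  finally have 1: "(norm (x - x1))\<^sup>2 \<le> (t - 1) * (b - c)" .
  have cs: "c \<le> norm (z1 - z0) * norm (x1 - x0)"
    unfolding c_def by (rule norm_cauchy_schwarz)
  have "t * b \<le> norm (z1 - z0) * norm (x1 - x0)"
  proof (cases "t = 1")
    case True
    with 1 have "x = x1" by simp
    then show ?thesis using True cs by (simp add: b_def c_def)
  next
    case False
    with 1 t have "b \<le> c"
      by (smt (verit) mult_less_0_iff zero_le_power2)
    moreover have "0 \<le> b \<or> t = 0" using 0 t by (smt (verit) mult_nonneg_nonpos zero_le_power2 mult_pos_neg)
    ultimately have "t * b \<le> norm (z1 - z0) * norm (x1 - x0)"
      using cs t mult_left_le_one_le[of b t] by auto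
    then show ?thesis .
  qed
  with 0 show ?thesis by linarith
qed

theorem ae_pointwise_Lipschitz:
  assumes "bounded U"
  shows "negligible {x0 \<in> D. \<not> (\<exists>C \<delta>. 0 < \<delta> \<and>
    (\<forall>x\<in>D. norm (x - x0) < \<delta> \<longrightarrow> norm (S x - S x0) \<le> C * norm (x - x0)))}"
    (is "negligible ?N")
proof -
  obtain B where B: "\<And>x. x \<in> U \<Longrightarrow> norm x \<le> B" using assms by (auto simp: bounded_iff)
  define g where "g z = (SOME x. related x (z - x))" for z
  have g: "related (g z) (z - g z)" for z
  proof -
    have "\<exists>x. related x (z - x)"
      unfolding related_def using mono by (rule monotone_minty)
    then show ?thesis unfolding g_def by (rule someI_ex)
  qed
  let ?n = "DIM('a)"
  have "\<exists>s W. 0 < s \<and> s < d \<and> W \<in> lmeasurable \<and> W \<subseteq> ball 0 (B + K + 1) \<and>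
      g ` W \<subseteq> cball x0 s \<and> m * measure lebesgue (cball x0 s) \<le> measure lebesgue W"
    if x0N: "x0 \<in> ?N" and m: "0 < m" and d: "0 < d" for x0 m d
  proof -
    have x0: "x0 \<in> D" using x0N by simp
    then have "x0 \<in> U" using D_sub by auto
    then obtain \<epsilon> where \<epsilon>: "\<epsilon> > 0" "cball x0 \<epsilon> \<subseteq> U" using open_U open_contains_cball by blast
    have K: "K \<ge> 0" using S_bound[OF x0] norm_ge_zero order_trans by blast
    \<comment> \<open>\<open>k\<close> balls of radius \<open>s / 2\<close> will be compared with
      one of radius \<open>2 * s\<close>, a volume ratio of \<open>k / 4 ^ ?n\<close>.\<close>
    obtain k :: nat where k: "m * 4 ^ ?n \<le> real k" using real_arch_simple by blast
    define \<sigma> where "\<sigma> = min (d / 4) (\<epsilon> / 2)"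
    have \<sigma>: "\<sigma> > 0" using d \<epsilon> by (simp add: \<sigma>_def)
    \<comment> \<open>This makes \<open>r * h\<close> less than the square of
      \<open>\<sigma>\<close>, hence \<open>s < \<sigma>\<close>. The cap 1 serves the bound
      \<open>r \<le> 2 * K + 1\<close>.\<close>
    define \<delta> where "\<delta> = min 1 (\<sigma>\<^sup>2 / (2 * K + 2))"
    have \<delta>: "\<delta> > 0" using \<sigma> K by (simp add: \<delta>_def)
    obtain x1 where x1: "x1 \<in> D" "norm (x1 - x0) < \<delta>"
      \<comment> \<open>The extra 1 in the slope absorbs \<open>x1 - x0\<close> in
        \<open>z1 - z0\<close>; what remains is the square of \<open>k\<close>, which gives
        \<open>k * s \<le> r\<close> after a square root.\<close>
      and steep: "norm (S x1 - S x0) > ((real k)\<^sup>2 + 1) * norm (x1 - x0)"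
      using x0N \<delta> by (auto simp: not_le)
    define h where "h = norm (x1 - x0)"
    have h: "h > 0" using steep by (cases "x1 = x0") (auto simp: h_def)
    define z0 z1 where "z0 = x0 + S x0" and "z1 = x1 + S x1"
    define r where "r = norm (z1 - z0)"
    have zz: "z1 - z0 = (S x1 - S x0) + (x1 - x0)" by (simp add: z0_def z1_def)
    have r_low: "r > (real k)\<^sup>2 * h"
      using steep norm_diff_ineq[of "S x1 - S x0" "x1 - x0"]
      by (simp add: r_def zz h_def algebra_simps)
    then have r: "r > 0" using h by (smt (verit) mult_nonneg_nonneg zero_le_power2)
    have "norm (S x1 - S x0) \<le> 2 * K"
      using norm_triangle_ineq4[of "S x1" "S x0"] S_bound[OF x0] S_bound[OF x1(1)] by linarith
    then have r_up: "r \<le> 2 * K + 1"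
      using norm_triangle_ineq[of "S x1 - S x0" "x1 - x0"] x1(2) by (simp add: r_def zz \<delta>_def)
    define s where "s = sqrt (r * h)"
    have s: "s > 0" using r h by (simp add: s_def)
    have s2: "s\<^sup>2 = r * h" using r h by (simp add: s_def)
    have "r * h < (2 * K + 2) * \<delta>"
      using r_up x1(2) h r K by (intro mult_strict_mono') (auto simp: h_def)
    also have "\<dots> \<le> (2 * K + 2) * (\<sigma>\<^sup>2 / (2 * K + 2))"
      using K by (intro mult_left_mono) (auto simp: \<delta>_def)
    also have "\<dots> = \<sigma>\<^sup>2" using K by (simp add: field_simps)
    finally have "s < \<sigma>" using \<sigma> s2 power2_less_imp_less[of s \<sigma>] by simp
    then have sd: "2 * s < d" "2 * s \<le> \<epsilon>" using s by (auto simp: \<sigma>_def)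
    have "(real k * s)\<^sup>2 = ((real k)\<^sup>2 * h) * r" by (simp add: power_mult_distrib s2)
    also have "\<dots> \<le> r * r" using r_low r by (intro mult_right_mono) auto
    finally have ksr: "real k * s \<le> r"
      using power2_le_imp_le[of "real k * s" r] r by (simp add: power2_eq_square)
    define p where "p j = z0 + (real j * s / r) *\<^sub>R (z1 - z0)" for j :: nat
    define W where "W = (\<Union>j<k. ball (p j) (s / 2))"
    \<comment> \<open>The steep secant from \<open>x0\<close> to \<open>x1\<close> is a segment of length \<open>r\<close> which \<open>g\<close> contracts to
      radius \<open>s\<close>, with \<open>r / s \<ge> k\<close>: room for \<open>k\<close> disjoint balls.\<close>
    have near: "norm (g z - x0) \<le> 2 * s" if "z \<in> W" for z
    proof -
      obtain j where j: "j < k" "norm (z - p j) < s / 2"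
        using \<open>z \<in> W\<close> by (auto simp: W_def dist_norm norm_minus_commute)
      have "real j * s \<le> r"
        using ksr j(1) s by (smt (verit) mult_right_mono of_nat_less_iff)
      then have "(norm (g (p j) - x0))\<^sup>2 \<le> r * h"
        using resolvent_segment[OF x0 x1(1) _ _ z0_def z1_def, of "real j * s / r" "g (p j)"]
          g[of "p j"] s r by (simp add: p_def r_def h_def)
      then have c: "norm (g (p j) - x0) \<le> s"
        using s2 s power2_le_imp_le[of "norm (g (p j) - x0)" s] by simp
      \<comment> \<open>\<open>resolvent_nonexpansive\<close> asks for one value in
        \<open>U\<close>. It then adds at most \<open>s / 2\<close> to the distance \<open>s\<close>
        reached at the centre of the ball.\<close>
      then have "g (p j) \<in> U" using \<epsilon>(2) sd s by (auto simp: dist_norm norm_minus_commute)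
      from resolvent_nonexpansive[OF g g this, of z] j(2) c s
      show ?thesis using norm_triangle_ineq[of "g z - g (p j)" "g (p j) - x0"] by simp
    qed
    \<comment> \<open>Since \<open>g z\<close> lies in \<open>U\<close>, both \<open>g z\<close> and
      \<open>z - g z\<close> are bounded, so one ball serves for all \<open>x0\<close>,
      \<open>m\<close> and \<open>d\<close>.\<close>
    have WV: "W \<subseteq> ball 0 (B + K + 1)"
    proof
      fix z assume "z \<in> W"
      then have "g z \<in> U" using near[of z] \<epsilon>(2) sd by (auto simp: dist_norm norm_minus_commute)
      from related_norm_le[OF g this] B[OF this]
      show "z \<in> ball 0 (B + K + 1)"
        using norm_triangle_ineq[of "g z" "z - g z"] by simp
    qed
    have "pairwise (\<lambda>i j. disjnt (ball (p i) (s / 2)) (ball (p j) (s / 2))) {..<k}"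
    proof (clarsimp simp: pairwise_def disjnt_def)
      fix i j :: nat assume ij: "i \<noteq> j"
      have "p i - p j = ((real i - real j) * s / r) *\<^sub>R (z1 - z0)"
        by (simp add: p_def algebra_simps diff_divide_distrib)
      then have "dist (p i) (p j) = \<bar>real i - real j\<bar> * s"
        using s r by (simp add: dist_norm abs_mult flip: r_def)
      also have "\<dots> \<ge> 1 * s" using ij s by (intro mult_right_mono) auto
      finally show "ball (p i) (s / 2) \<inter> ball (p j) (s / 2) = {}"
        by (intro disjoint_ballI) simp
    qed
    then have "measure lebesgue W = (\<Sum>j<k. measure lebesgue (ball (p j) (s / 2)))"
      unfolding W_def by (intro measure_UNION') auto
    also have "\<dots> = real k * ((s / 2) ^ ?n * measure lborel (ball (0::'a) 1))"
      using s by (simp add: content_ball_conv_unit_ball[of "s / 2"])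
    finally have mW: "measure lebesgue W = real k * ((s / 2) ^ ?n * measure lborel (ball (0::'a) 1))" .
    have "m * measure lebesgue (cball x0 (2 * s)) = m * ((2 * s) ^ ?n * measure lborel (ball (0::'a) 1))"
      using s content_ball_conv_unit_ball[of "2 * s" x0] content_cball_conv_ball[of x0 "2 * s"] by simp
    also have "(2 * s) ^ ?n = 4 ^ ?n * (s / 2) ^ ?n" using power_mult_distrib[of 4 "s / 2" ?n] by simp
    also have "m * (4 ^ ?n * (s / 2) ^ ?n * measure lborel (ball (0::'a) 1))
      = (m * 4 ^ ?n) * ((s / 2) ^ ?n * measure lborel (ball (0::'a) 1))" by simp
    also have "\<dots> \<le> measure lebesgue W"
      unfolding mW using s by (intro mult_right_mono[OF k]) simp
    finally have "m * measure lebesgue (cball x0 (2 * s)) \<le> measure lebesgue W" .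
    moreover have "W \<in> lmeasurable" unfolding W_def by (intro fmeasurable.finite_UN) auto
    moreover have "g ` W \<subseteq> cball x0 (2 * s)"
      using near by (auto simp: dist_norm norm_minus_commute)
    ultimately show ?thesis using s sd WV by (intro exI[of _ "2 * s"] exI[of _ W]) auto
  qed
  then show ?thesis
    by (rule vitali_negligible[OF lmeasurable_ball]) assumption+
qed

end

subsection \<open>Homogeneous elliptic costs\<close>

text \<open>The Hessian enters through its action \<open>A x v\<close>, free of coordinates;
  \<open>theorem5p5\<close> instantiates it with a matrix product.\<close>

locale elliptic_cost =
  fixes h :: "'a::euclidean_space \<Rightarrow> real" and G :: "'a \<Rightarrow> 'a" and A :: "'a \<Rightarrow> 'a \<Rightarrow> 'a"
    and p lam Lam :: real
  assumes p: "p \<ge> 2"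
    and grad: "\<And>x. (h has_derivative (\<lambda>v. G x \<bullet> v)) (at x)"
    and hess: "\<And>x. (G has_derivative A x) (at x)"
    and hess_cont: "\<And>v. continuous_on UNIV (\<lambda>x. A x v)"
    and homog: "\<And>t x. t > 0 \<Longrightarrow> h (t *\<^sub>R x) = t powr p * h x"
    and lam_pos: "0 < lam" and Lam_pos: "0 \<le> Lam"
    and elliptic: "\<And>x v. norm x = 1 \<Longrightarrow>
        lam * (norm v)\<^sup>2 \<le> v \<bullet> A x v \<and> v \<bullet> A x v \<le> Lam * (norm v)\<^sup>2"
begin

lemma cost_continuous: "continuous_on UNIV h"
  using has_derivative_continuous[OF grad] by (auto simp: continuous_on_eq_continuous_at)

lemma gradient_continuous: "continuous_on UNIV G"
  using has_derivative_continuous[OF hess] by (auto simp: continuous_on_eq_continuous_at)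

section \<open>Homogeneity and size of the derivatives of the cost\<close>

lemma gradient_homog:
  assumes t: "t > 0"
  shows "G (t *\<^sub>R x) = t powr (p - 1) *\<^sub>R G x"
proof -
  have "((\<lambda>x. h (t *\<^sub>R x)) has_derivative (\<lambda>v. G (t *\<^sub>R x) \<bullet> (t *\<^sub>R v))) (at x)"
    by (rule has_derivative_compose[where g = h, OF _ grad]) (auto intro!: derivative_eq_intros)
  moreover have "((\<lambda>x. h (t *\<^sub>R x)) has_derivative (\<lambda>v. t powr p * (G x \<bullet> v))) (at x)"
    unfolding homog[OF t] by (intro has_derivative_mult_right grad)
  ultimately have "(\<lambda>v. G (t *\<^sub>R x) \<bullet> (t *\<^sub>R v)) = (\<lambda>v. t powr p * (G x \<bullet> v))"
    by (rule has_derivative_unique)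
  then have eq: "t * (G (t *\<^sub>R x) \<bullet> v) = t powr p * (G x \<bullet> v)" for v
    by (simp add: fun_eq_iff)
  have "G (t *\<^sub>R x) \<bullet> v = (t powr (p - 1) *\<^sub>R G x) \<bullet> v" for v
    using eq[of v] t by (simp add: powr_diff field_simps)
  then show ?thesis by (metis vector_eq_rdot)
qed

lemma gradient_zero: "G 0 = 0"
proof -
  have "(2::real) powr (p - 1) > 1" using p by simp
  moreover have "(2 powr (p - 1) - 1) *\<^sub>R G 0 = 0"
    using gradient_homog[of 2 0] by (simp add: scaleR_diff_left)
  ultimately show ?thesis using p by simp
qed

lemma hessian_homog:
  assumes t: "t > 0"
  shows "A (t *\<^sub>R x) v = t powr (p - 2) *\<^sub>R A x v"
proof -
  have "((\<lambda>x. G (t *\<^sub>R x)) has_derivative (\<lambda>v. A (t *\<^sub>R x) (t *\<^sub>R v))) (at x)"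
    by (rule has_derivative_compose[where g = G, OF _ hess]) (auto intro!: derivative_eq_intros)
  moreover have "((\<lambda>x. G (t *\<^sub>R x)) has_derivative (\<lambda>v. t powr (p - 1) *\<^sub>R A x v)) (at x)"
    unfolding gradient_homog[OF t] by (intro has_derivative_scaleR_right hess)
  ultimately have "(\<lambda>v. A (t *\<^sub>R x) (t *\<^sub>R v)) = (\<lambda>v. t powr (p - 1) *\<^sub>R A x v)"
    by (rule has_derivative_unique)
  then have "A (t *\<^sub>R x) (t *\<^sub>R v) = t powr (p - 1) *\<^sub>R A x v" by (simp add: fun_eq_iff)
  moreover have "A (t *\<^sub>R x) (t *\<^sub>R v) = t *\<^sub>R A (t *\<^sub>R x) v"
    using hess by (intro linear_cmul has_derivative_linear)
  moreover have "t powr (p - 1) = t * t powr (p - 2)"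
    using t by (simp add: powr_diff powr_numeral power2_eq_square)
  ultimately have "t *\<^sub>R A (t *\<^sub>R x) v = t *\<^sub>R (t powr (p - 2) *\<^sub>R A x v)" by simp
  with t show ?thesis by (simp only: scaleR_cancel_left) simp
qed

lemma hessian_bounds:
  assumes "x \<noteq> 0"
  shows "lam * norm x powr (p - 2) * (norm v)\<^sup>2 \<le> v \<bullet> A x v"
    and "v \<bullet> A x v \<le> Lam * norm x powr (p - 2) * (norm v)\<^sup>2"
proof -
  have "A x v = A (norm x *\<^sub>R sgn x) v" using assms by (simp add: sgn_div_norm)
  also have "\<dots> = norm x powr (p - 2) *\<^sub>R A (sgn x) v" using assms by (simp add: hessian_homog)
  finally have e: "v \<bullet> A x v = norm x powr (p - 2) * (v \<bullet> A (sgn x) v)" by simp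
  have "norm (sgn x) = 1" using assms by (simp add: norm_sgn)
  from elliptic[OF this, of v] show
    "lam * norm x powr (p - 2) * (norm v)\<^sup>2 \<le> v \<bullet> A x v"
    "v \<bullet> A x v \<le> Lam * norm x powr (p - 2) * (norm v)\<^sup>2"
    unfolding e by (metis mult.assoc mult.commute mult_left_mono powr_ge_zero)+
qed

text \<open>Scaling does not reach the origin, where the Hessian need not vanish if
  \<open>p = 2\<close>. The bounds come from continuity along a sequence tending to 0, on which the
  factor of exponent \<open>p - 2\<close> is at most 1.\<close>

lemma hessian_bounds_0: "0 \<le> v \<bullet> A 0 v" "v \<bullet> A 0 v \<le> Lam * (norm v)\<^sup>2"
proof -
  obtain b :: 'a where b: "b \<in> Basis" using nonempty_Basis by blast
  define x where "x n = inverse (real (Suc n)) *\<^sub>R b" for n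
  have nx: "norm (x n) = inverse (real (Suc n))" for n using b by (simp add: x_def)
  have "x \<longlonglongrightarrow> 0 *\<^sub>R b"
    unfolding x_def by (intro tendsto_intros LIMSEQ_inverse_real_of_nat)
  then have "x \<longlonglongrightarrow> 0" by simp
  then have "(\<lambda>n. A (x n) v) \<longlonglongrightarrow> A 0 v"
    using continuous_on_tendsto_compose[OF hess_cont] by auto
  then have lim: "(\<lambda>n. v \<bullet> A (x n) v) \<longlonglongrightarrow> v \<bullet> A 0 v" by (intro tendsto_intros)
  have x0: "x n \<noteq> 0" for n using nx[of n] by auto
  have "0 \<le> v \<bullet> A (x n) v" for n
    using hessian_bounds(1)[OF x0[of n], of v] lam_pos
    by (smt (verit) mult_nonneg_nonneg powr_ge_zero zero_le_power2)
  then show "0 \<le> v \<bullet> A 0 v" by (intro LIMSEQ_le_const[OF lim]) auto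
  have "v \<bullet> A (x n) v \<le> Lam * (norm v)\<^sup>2" for n
  proof -
    have "norm (x n) \<le> 1" by (simp add: nx field_simps)
    then have "norm (x n) powr (p - 2) \<le> 1" using p by (intro powr_le1) auto
    then have "Lam * norm (x n) powr (p - 2) * (norm v)\<^sup>2 \<le> Lam * 1 * (norm v)\<^sup>2"
      using Lam_pos by (intro mult_right_mono mult_left_mono) auto
    with hessian_bounds(2)[OF x0[of n], of v] show ?thesis by simp
  qed
  then show "v \<bullet> A 0 v \<le> Lam * (norm v)\<^sup>2" by (intro LIMSEQ_le_const2[OF lim]) auto
qed

lemma hessian_nonneg: "0 \<le> v \<bullet> A x v"
proof (cases "x = 0")
  case False
  then show ?thesis
    using hessian_bounds(1)[of x v] lam_pos
    by (smt (verit) mult_nonneg_nonneg powr_ge_zero zero_le_power2)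
qed (simp add: hessian_bounds_0)

lemma hessian_le:
  assumes "norm x \<le> R" "1 \<le> R"
  shows "v \<bullet> A x v \<le> Lam * R powr (p - 2) * (norm v)\<^sup>2"
proof (cases "x = 0")
  case True
  have "Lam * 1 * (norm v)\<^sup>2 \<le> Lam * R powr (p - 2) * (norm v)\<^sup>2"
    using Lam_pos assms p by (intro mult_right_mono mult_left_mono ge_one_powr_ge_zero) auto
  then show ?thesis using True hessian_bounds_0(2)[of v] by simp
next
  case False
  have "Lam * norm x powr (p - 2) * (norm v)\<^sup>2 \<le> Lam * R powr (p - 2) * (norm v)\<^sup>2"
    using Lam_pos assms p by (intro mult_right_mono mult_left_mono powr_mono2) auto
  then show ?thesis using hessian_bounds(2)[OF False, of v] by linarith
qed

section \<open>Monotonicity and convexity along segments\<close>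

lemma gradient_mvt:
  assumes "s < t"
  obtains z where "s < z" "z < t"
    "(G (b + t *\<^sub>R v) - G (b + s *\<^sub>R v)) \<bullet> v = (t - s) * (v \<bullet> A (b + z *\<^sub>R v) v)"
proof -
  have "((\<lambda>t. G (b + t *\<^sub>R v) \<bullet> v) has_real_derivative (v \<bullet> A (b + z *\<^sub>R v) v)) (at z)" for z
  proof -
    have "((\<lambda>t. G (b + t *\<^sub>R v)) has_derivative (\<lambda>u. A (b + z *\<^sub>R v) (u *\<^sub>R v))) (at z)"
      by (rule has_derivative_compose[where g = G, OF _ hess]) (auto intro!: derivative_eq_intros)
    then have D: "((\<lambda>t. G (b + t *\<^sub>R v) \<bullet> v) has_derivative (\<lambda>u. A (b + z *\<^sub>R v) (u *\<^sub>R v) \<bullet> v)) (at z)"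
      by (rule has_derivative_inner_left)
    have "A (b + z *\<^sub>R v) (u *\<^sub>R v) = u *\<^sub>R A (b + z *\<^sub>R v) v" for u
      using hess by (intro linear_cmul has_derivative_linear)
    then show ?thesis
      by (intro has_derivative_imp_has_field_derivative[OF D]) (simp add: inner_commute)
  qed
  from MVT2[OF assms this] obtain z where "s < z" "z < t"
    "G (b + t *\<^sub>R v) \<bullet> v - G (b + s *\<^sub>R v) \<bullet> v = (t - s) * (v \<bullet> A (b + z *\<^sub>R v) v)"
    by blast
  with that show thesis by (simp add: inner_diff_left)
qed

lemma gradient_line_mono:
  assumes "s \<le> t"
  shows "0 \<le> (G (b + t *\<^sub>R v) - G (b + s *\<^sub>R v)) \<bullet> v"
proof (cases "s = t")
  case False
  then have "s < t" using assms by simp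
  then obtain z where "s < z" "z < t"
    "(G (b + t *\<^sub>R v) - G (b + s *\<^sub>R v)) \<bullet> v = (t - s) * (v \<bullet> A (b + z *\<^sub>R v) v)"
    by (rule gradient_mvt)
  then show ?thesis using assms hessian_nonneg by simp
qed simp

lemma gradient_le:
  assumes "norm a \<le> R" "norm b \<le> R" "1 \<le> R"
  shows "(G a - G b) \<bullet> (a - b) \<le> Lam * R powr (p - 2) * (norm (a - b))\<^sup>2"
proof -
  obtain z where z: "0 < z" "z < 1"
    "(G a - G b) \<bullet> (a - b) = (a - b) \<bullet> A (b + z *\<^sub>R (a - b)) (a - b)"
    using gradient_mvt[of 0 1 b "a - b"] by auto
  have "b + z *\<^sub>R (a - b) = (1 - z) *\<^sub>R b + z *\<^sub>R a" by (simp add: algebra_simps)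
  moreover have "(1 - z) *\<^sub>R b + z *\<^sub>R a \<in> cball 0 R"
    using assms z by (intro convexD_alt convex_cball) auto
  ultimately show ?thesis unfolding z(3) using assms(3) by (intro hessian_le) auto
qed

text \<open>The lower Hessian bound degenerates at the origin if \<open>p > 2\<close>, so growth is
  taken from one quarter of the segment, where the mean value theorem applies away from 0. Its
  length gives the factor 1/4, its distance from 0 the power of 1/4; elsewhere monotonicity
  suffices.\<close>

lemma gradient_uniform_mono:
  "lam / 4 * (1 / 4) powr (p - 2) * norm (a - b) powr p \<le> (G a - G b) \<bullet> (a - b)"
proof (cases "a = b")
  case False
  define v where "v = a - b"
  have v: "norm v > 0" using False by (simp add: v_def)
  \<comment> \<open>The segment stays within \<open>norm v / 4\<close> of the origin only on an interval of length at most \<open>1/2\<close>.\<close>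
  have "(\<forall>t. 0 < t \<and> t < 1/4 \<longrightarrow> norm v / 4 \<le> norm (b + t *\<^sub>R v)) \<or>
        (\<forall>t. 3/4 < t \<and> t < 1 \<longrightarrow> norm v / 4 \<le> norm (b + t *\<^sub>R v))"
  proof (rule ccontr)
    assume "\<not> ?thesis"
    then obtain t t' where t: "0 < t" "t < 1/4" "norm (b + t *\<^sub>R v) < norm v / 4"
      and t': "3/4 < t'" "t' < 1" "norm (b + t' *\<^sub>R v) < norm v / 4" by (auto simp: not_le)
    have "(b + t' *\<^sub>R v) - (b + t *\<^sub>R v) = (t' - t) *\<^sub>R v" by (simp add: algebra_simps)
    then have "(t' - t) * norm v \<le> norm (b + t' *\<^sub>R v) + norm (b + t *\<^sub>R v)"
      using norm_triangle_ineq4[of "b + t' *\<^sub>R v" "b + t *\<^sub>R v"] t(2) t'(1) by simp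
    moreover have "(1 / 2) * norm v \<le> (t' - t) * norm v" using t t' by (intro mult_right_mono) auto
    ultimately show False using t(3) t'(3) by linarith
  qed
  then obtain s where s: "0 \<le> s" "s + 1/4 \<le> 1"
    and far: "\<And>t. \<lbrakk>s < t; t < s + 1/4\<rbrakk> \<Longrightarrow> norm v / 4 \<le> norm (b + t *\<^sub>R v)"
  proof
    assume "\<forall>t. 0 < t \<and> t < 1/4 \<longrightarrow> norm v / 4 \<le> norm (b + t *\<^sub>R v)"
    then show thesis by (intro that[of 0]) auto
  next
    assume "\<forall>t. 3/4 < t \<and> t < 1 \<longrightarrow> norm v / 4 \<le> norm (b + t *\<^sub>R v)"
    then show thesis by (intro that[of "3/4"]) auto
  qed
  obtain z where z: "s < z" "z < s + 1/4"
    "(G (b + (s + 1/4) *\<^sub>R v) - G (b + s *\<^sub>R v)) \<bullet> v = 1/4 * (v \<bullet> A (b + z *\<^sub>R v) v)"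
    using gradient_mvt[of s "s + 1/4" b v] by auto
  have near: "norm v / 4 \<le> norm (b + z *\<^sub>R v)" using far z by simp
  then have nz: "b + z *\<^sub>R v \<noteq> 0" using v by auto
  have "lam * (norm v / 4) powr (p - 2) * (norm v)\<^sup>2
     \<le> lam * norm (b + z *\<^sub>R v) powr (p - 2) * (norm v)\<^sup>2"
    using near p lam_pos by (intro mult_right_mono mult_left_mono powr_mono2) auto
  also have "\<dots> \<le> v \<bullet> A (b + z *\<^sub>R v) v" by (rule hessian_bounds(1)[OF nz])
  finally have low: "lam * (norm v / 4) powr (p - 2) * (norm v)\<^sup>2 \<le> v \<bullet> A (b + z *\<^sub>R v) v" .
  have "norm v powr p = norm v powr (p - 2) * (norm v)\<^sup>2"
    using v by (simp add: powr_diff powr_numeral)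
  then have "lam / 4 * (1 / 4) powr (p - 2) * norm v powr p
      = 1/4 * (lam * (norm v / 4) powr (p - 2) * (norm v)\<^sup>2)"
    by (simp add: powr_divide)
  also have "\<dots> \<le> (G (b + (s + 1/4) *\<^sub>R v) - G (b + s *\<^sub>R v)) \<bullet> v"
    unfolding z(3) using low by simp
  also have "\<dots> \<le> (G (b + 1 *\<^sub>R v) - G (b + 0 *\<^sub>R v)) \<bullet> v"
    using gradient_line_mono[of 0 s b v] gradient_line_mono[of "s + 1/4" 1 b v] s
    by (simp add: inner_diff_left)
  finally show ?thesis by (simp add: v_def)
qed simp

lemma cost_mvt:
  obtains z where "0 < z" "z < 1" "h x - h y = G (y + z *\<^sub>R (x - y)) \<bullet> (x - y)"
proof -
  have "((\<lambda>t. h (y + t *\<^sub>R (x - y))) has_real_derivative G (y + z *\<^sub>R (x - y)) \<bullet> (x - y)) (at z)" for z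
  proof -
    have D: "((\<lambda>t. h (y + t *\<^sub>R (x - y))) has_derivative (\<lambda>u. G (y + z *\<^sub>R (x - y)) \<bullet> (u *\<^sub>R (x - y)))) (at z)"
      by (rule has_derivative_compose[where g = h, OF _ grad]) (auto intro!: derivative_eq_intros)
    show ?thesis by (rule has_derivative_imp_has_field_derivative[OF D]) simp
  qed
  from MVT2[of 0 1, OF _ this] that show thesis by auto
qed

lemma cost_lower: "G y \<bullet> (x - y) \<le> h x - h y"
proof -
  obtain z where z: "0 < z" "z < 1" "h x - h y = G (y + z *\<^sub>R (x - y)) \<bullet> (x - y)" by (rule cost_mvt)
  show ?thesis using gradient_line_mono[of 0 z y "x - y"] z by (simp add: inner_diff_left)
qed

lemma cost_upper:
  assumes "norm x \<le> R" "norm y \<le> R" "1 \<le> R"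
  shows "h x - h y \<le> G y \<bullet> (x - y) + Lam * R powr (p - 2) * (norm (x - y))\<^sup>2"
proof -
  have "h x - h y \<le> G x \<bullet> (x - y)"
    using cost_lower[of x y] by (simp add: inner_diff_right)
  also have "\<dots> \<le> G y \<bullet> (x - y) + Lam * R powr (p - 2) * (norm (x - y))\<^sup>2"
    using gradient_le[OF assms] by (simp add: inner_diff_left)
  finally show ?thesis .
qed

end

subsection \<open>Almost everywhere regularity of h-monotone maps\<close>

lemma dense_if_negligible_compl:
  fixes D :: "'a::euclidean_space set"
  assumes "negligible (- D)"
  shows "closure D = UNIV"
proof (rule ccontr)
  assume "closure D \<noteq> UNIV"
  then have "- closure D \<noteq> {}" by auto
  then have "\<not> negligible (- closure D)" by (intro open_not_negligible) auto
  moreover have "- closure D \<subseteq> - D" using closure_subset by auto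
  ultimately show False using assms negligible_subset by blast
qed

context elliptic_cost
begin

text \<open>If \<open>f\<close> blows up along points tending to \<open>a\<close>, with
  \<open>- sgn\<close> of its values tending to \<open>e\<close>, convexity bounds
  \<open>h (X n - \<xi> n) - h (y - \<xi> n)\<close> below by a quantity of order
  \<open>norm (\<xi> n) powr (p - 1)\<close>, provided \<open>y\<close> satisfies
  \<open>0 < G e \<bullet> (a - y)\<close>. By h-monotonicity the same difference is at most a
  convergent sequence.\<close>

lemma h_monotone_locally_bounded:
  assumes dense: "closure D = UNIV"
    and mono: "\<And>x y. \<lbrakk>x \<in> D; y \<in> D\<rbrakk> \<Longrightarrow> h (x - f x) + h (y - f y) \<le> h (x - f y) + h (y - f x)"
  shows "\<exists>\<delta> K. 0 < \<delta> \<and> (\<forall>x\<in>D \<inter> ball a \<delta>. norm (f x) \<le> K)"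
proof (rule ccontr)
  assume unb: "\<not> ?thesis"
  have unb': "\<exists>x\<in>D \<inter> ball a \<delta>. K < norm (f x)" if "\<delta> > 0" for \<delta> K
    using unb that by (auto simp: not_le)
  define x where "x n = (SOME x. x \<in> D \<and> dist a x < inverse (real (Suc n)) \<and> real (Suc n) < norm (f x))" for n
  have "x n \<in> D \<and> dist a (x n) < inverse (real (Suc n)) \<and> real (Suc n) < norm (f (x n))" for n
    unfolding x_def
    by (rule someI_ex) (use unb'[of "inverse (real (Suc n))" "real (Suc n)"] in auto)
  then have x: "\<And>n. x n \<in> D" "\<And>n. dist a (x n) < inverse (real (Suc n))"
    "\<And>n. real (Suc n) < norm (f (x n))"
    by blast+
  have "compact (sphere (0::'a) 1)" by simp
  moreover have "\<forall>n. - sgn (f (x n)) \<in> sphere 0 1"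
  proof
    fix n
    have "f (x n) \<noteq> 0" using x(3)[of n] by auto
    then show "- sgn (f (x n)) \<in> sphere 0 1" by (simp add: norm_sgn)
  qed
  ultimately obtain e r where e: "e \<in> sphere 0 1" and r: "strict_mono r"
    and lim: "((\<lambda>n. - sgn (f (x n))) \<circ> r) \<longlonglongrightarrow> e"
    unfolding compact_def by metis
  have "0 < lam / 4 * (1 / 4) powr (p - 2) * norm (e - 0) powr p"
    using lam_pos e by auto
  then have pos: "G e \<bullet> e > 0"
    using gradient_uniform_mono[of e 0] by (simp add: gradient_zero)
  \<comment> \<open>An open half-space, nonempty because it contains \<open>a - e\<close>; density
    of \<open>D\<close> then provides the test point \<open>y\<close>.\<close>
  define O' where "O' = {y. 0 < G e \<bullet> (a - y)}"
  have "open O'" unfolding O'_def by (intro open_Collect_less continuous_intros)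
  moreover have "a - e \<in> O'" using pos by (simp add: O'_def)
  ultimately have "D \<inter> O' \<noteq> {}"
    using dense open_Int_closure_eq_empty[of O' D] by auto
  then obtain y where y: "y \<in> D" "0 < G e \<bullet> (a - y)" by (auto simp: O'_def)
  define X where "X n = x (r n)" for n
  define \<xi> where "\<xi> n = f (X n)" for n
  have \<xi>_big: "real (Suc n) \<le> norm (\<xi> n)" for n
    using x(3)[of "r n"] seq_suble[OF r, of n] by (simp add: \<xi>_def X_def)
  then have \<xi>_pos: "norm (\<xi> n) \<ge> 1" for n by (smt (verit) of_nat_Suc of_nat_0_le_iff)
  have "(\<lambda>n. dist a (x n)) \<longlonglongrightarrow> 0"
    by (rule tendsto_sandwich[OF _ _ tendsto_const LIMSEQ_inverse_real_of_nat])
      (use less_imp_le[OF x(2)] in \<open>simp_all del: of_nat_Suc\<close>)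
  then have "x \<longlonglongrightarrow> a"
    unfolding dist_commute[of a] by (rule tendsto_dist_iff[THEN iffD2])
  then have X_lim: "X \<longlonglongrightarrow> a" using LIMSEQ_subseq_LIMSEQ[OF _ r] by (simp add: X_def[abs_def] o_def)
  have sgn_lim: "(\<lambda>n. - sgn (\<xi> n)) \<longlonglongrightarrow> e" using lim by (simp add: o_def \<xi>_def X_def)
  have norm_top: "filterlim (\<lambda>n. norm (\<xi> n)) at_top sequentially"
    by (rule filterlim_at_top_mono[OF filterlim_real_sequentially])
      (use \<xi>_big in \<open>auto intro!: always_eventually\<close>, smt (verit) of_nat_Suc)
  have "(\<lambda>n. inverse (norm (\<xi> n)) *\<^sub>R y - sgn (\<xi> n)) \<longlonglongrightarrow> 0 *\<^sub>R y + e"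
    unfolding diff_conv_add_uminus
    by (intro tendsto_intros sgn_lim tendsto_inverse_0_at_top[OF norm_top])
  then have "(\<lambda>n. inverse (norm (\<xi> n)) *\<^sub>R y - sgn (\<xi> n)) \<longlonglongrightarrow> e" by simp
  then have "(\<lambda>n. G (inverse (norm (\<xi> n)) *\<^sub>R y - sgn (\<xi> n))) \<longlonglongrightarrow> G e"
    using continuous_on_tendsto_compose[OF gradient_continuous] by auto
  then have inner_lim: "(\<lambda>n. G (inverse (norm (\<xi> n)) *\<^sub>R y - sgn (\<xi> n)) \<bullet> (X n - y)) \<longlonglongrightarrow> G e \<bullet> (a - y)"
    by (intro tendsto_intros X_lim)
  have powr_top: "filterlim (\<lambda>n. norm (\<xi> n) powr (p - 1)) at_top sequentially"
  proof (rule filterlim_at_top_mono[OF norm_top], rule always_eventually, rule allI)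
    fix n
    show "norm (\<xi> n) \<le> norm (\<xi> n) powr (p - 1)"
      using powr_mono[of 1 "p - 1" "norm (\<xi> n)"] p \<xi>_pos[of n] by simp
  qed
  have top: "filterlim (\<lambda>n. G (inverse (norm (\<xi> n)) *\<^sub>R y - sgn (\<xi> n)) \<bullet> (X n - y) * norm (\<xi> n) powr (p - 1)) at_top sequentially"
    by (rule filterlim_tendsto_pos_mult_at_top[OF inner_lim y(2) powr_top])
  have le: "G (inverse (norm (\<xi> n)) *\<^sub>R y - sgn (\<xi> n)) \<bullet> (X n - y) * norm (\<xi> n) powr (p - 1)
      \<le> h (X n - f y) - h (y - f y)" for n
  proof -
    have n0: "norm (\<xi> n) > 0" using \<xi>_pos[of n] by linarith
    have "y - \<xi> n = norm (\<xi> n) *\<^sub>R (inverse (norm (\<xi> n)) *\<^sub>R y - sgn (\<xi> n))"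
      using n0 by (simp add: scaleR_diff_right sgn_div_norm)
    then have "G (y - \<xi> n) = norm (\<xi> n) powr (p - 1) *\<^sub>R G (inverse (norm (\<xi> n)) *\<^sub>R y - sgn (\<xi> n))"
      using gradient_homog[OF n0] by metis
    then have "G (inverse (norm (\<xi> n)) *\<^sub>R y - sgn (\<xi> n)) \<bullet> (X n - y) * norm (\<xi> n) powr (p - 1)
        = G (y - \<xi> n) \<bullet> ((X n - \<xi> n) - (y - \<xi> n))" by simp
    also have "\<dots> \<le> h (X n - \<xi> n) - h (y - \<xi> n)" by (rule cost_lower)
    also have "\<dots> \<le> h (X n - f y) - h (y - f y)"
      using mono[OF x(1) y(1), of "r n"] by (simp add: \<xi>_def X_def)
    finally show ?thesis .
  qed
  have "filterlim (\<lambda>n. h (X n - f y) - h (y - f y)) at_top sequentially"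
    by (rule filterlim_at_top_mono[OF top]) (simp add: le)
  moreover have "(\<lambda>n. h (X n - f y) - h (y - f y)) \<longlonglongrightarrow> h (a - f y) - h (y - f y)"
    using continuous_on_tendsto_compose[OF cost_continuous tendsto_diff[OF X_lim tendsto_const]]
    by (intro tendsto_intros) auto
  ultimately show False
    using not_tendsto_and_filterlim_at_infinity[OF _ _ filterlim_at_top_imp_at_infinity] by auto
qed

text \<open>For a suitable constant \<open>C\<close> the map \<open>2C x - G (x - f x)\<close> is monotone near \<open>a\<close>;
  in the cyclically monotone case this is the semiconvexity of the Kantorovich potential.\<close>

lemma h_monotone_ae_pointwise_Lipschitz:
  assumes dense: "closure D = UNIV"
    and mono: "\<And>x y. \<lbrakk>x \<in> D; y \<in> D\<rbrakk> \<Longrightarrow> h (x - f x) + h (y - f y) \<le> h (x - f y) + h (y - f x)"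
  shows "\<exists>\<delta>>0. negligible {x0 \<in> D \<inter> ball a \<delta>. \<not> (\<exists>C \<epsilon>. 0 < \<epsilon> \<and>
    (\<forall>x\<in>D. norm (x - x0) < \<epsilon> \<longrightarrow> norm (G (x - f x) - G (x0 - f x0)) \<le> C * norm (x - x0)))}"
proof -
  obtain \<delta> K where \<delta>: "\<delta> > 0" and K: "\<And>x. x \<in> D \<inter> ball a \<delta> \<Longrightarrow> norm (f x) \<le> K"
    using h_monotone_locally_bounded[OF dense mono] by metis
  \<comment> \<open>Bounds every \<open>x - f y\<close> with both points in the ball;
    \<open>cost_upper\<close> also requires it to be at least 1.\<close>
  define R where "R = max 1 (norm a + \<delta> + K)"
  define C where "C = Lam * R powr (p - 2)"
  have C: "C \<ge> 0" using Lam_pos by (simp add: C_def)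
  have ball: "norm x \<le> norm a + \<delta>" if "x \<in> ball a \<delta>" for x
    using that norm_triangle_sub[of x a] by (auto simp: dist_norm norm_minus_commute)
  have R: "norm (x - f y) \<le> R" if "x \<in> D \<inter> ball a \<delta>" "y \<in> D \<inter> ball a \<delta>" for x y
    using norm_triangle_ineq4[of x "f y"] K[OF that(2)] ball[of x] that(1) by (simp add: R_def)
  have R1: "1 \<le> R" by (simp add: R_def)
  have "compact (G ` cball 0 R)"
    by (intro compact_continuous_image continuous_on_subset[OF gradient_continuous]) auto
  then obtain M where "\<forall>y\<in>G ` cball 0 R. norm y \<le> M"
    using compact_imp_bounded bounded_iff by blast
  then have M: "norm (G x) \<le> M" if "norm x \<le> R" for x using that by simp
  define S where "S x = (2 * C) *\<^sub>R x - G (x - f x)" for x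
  interpret S: bounded_monotone_dense S "D \<inter> ball a \<delta>" "ball a \<delta>" "2 * C * (norm a + \<delta>) + M"
  proof
    show "open (ball a \<delta>)" "D \<inter> ball a \<delta> \<subseteq> ball a \<delta>" by auto
    show "ball a \<delta> \<subseteq> closure (D \<inter> ball a \<delta>)"
      using open_Int_closure_subset[of "ball a \<delta>" D] dense by (simp add: Int_commute)
    fix x assume x: "x \<in> D \<inter> ball a \<delta>"
    have "norm (S x) \<le> 2 * C * norm x + norm (G (x - f x))"
      using norm_triangle_ineq4[of "(2 * C) *\<^sub>R x" "G (x - f x)"] C by (simp add: S_def)
    also have "\<dots> \<le> 2 * C * (norm a + \<delta>) + M"
      using x C by (intro add_mono mult_left_mono ball M R) auto
    finally show "norm (S x) \<le> 2 * C * (norm a + \<delta>) + M" .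
    fix y assume y: "y \<in> D \<inter> ball a \<delta>"
    \<comment> \<open>Each cross term is expanded about the diagonal term with the same value of
      \<open>f\<close>, so the increments are \<open>y - x\<close> and \<open>x - y\<close>.
      Inserted into h-monotonicity, the two expansions leave only the gradient difference and the
      quadratic errors.\<close>
    have "h (y - f x) - h (x - f x) \<le> G (x - f x) \<bullet> (y - x) + C * (norm (y - x))\<^sup>2"
      using cost_upper[OF R[OF y x] R[OF x x] R1] by (simp add: C_def)
    moreover have "h (x - f y) - h (y - f y) \<le> G (y - f y) \<bullet> (x - y) + C * (norm (x - y))\<^sup>2"
      using cost_upper[OF R[OF x y] R[OF y y] R1] by (simp add: C_def)
    moreover have "h (x - f x) + h (y - f y) \<le> h (x - f y) + h (y - f x)"
      using mono x y by simp
    moreover have "G (x - f x) \<bullet> (y - x) = - (G (x - f x) \<bullet> (x - y))"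
      by (simp add: inner_diff_right)
    ultimately have "(G (x - f x) - G (y - f y)) \<bullet> (x - y) \<le> 2 * C * (norm (x - y))\<^sup>2"
      by (simp add: inner_diff_left norm_minus_commute)
    also have "\<dots> = ((2 * C) *\<^sub>R (x - y)) \<bullet> (x - y)" by (simp add: power2_norm_eq_inner)
    finally show "0 \<le> (S x - S y) \<bullet> (x - y)"
      by (simp add: S_def inner_diff_left scaleR_diff_right)
  qed
  let ?P = "\<lambda>x0. \<exists>C \<epsilon>. 0 < \<epsilon> \<and>
    (\<forall>x\<in>D. norm (x - x0) < \<epsilon> \<longrightarrow> norm (G (x - f x) - G (x0 - f x0)) \<le> C * norm (x - x0))"
  have "?P x0" if x0: "x0 \<in> ball a \<delta>" and "0 < \<epsilon>"
    and lip: "\<forall>x\<in>D \<inter> ball a \<delta>. norm (x - x0) < \<epsilon> \<longrightarrow> norm (S x - S x0) \<le> L * norm (x - x0)"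
    for x0 \<epsilon> L
  proof -
    obtain \<rho> where \<rho>: "\<rho> > 0" "ball x0 \<rho> \<subseteq> ball a \<delta>" using x0 open_ball openE by blast
    have "norm (G (x - f x) - G (x0 - f x0)) \<le> (2 * C + L) * norm (x - x0)"
      if x: "x \<in> D" "norm (x - x0) < min \<epsilon> \<rho>" for x
    proof -
      have "x \<in> ball a \<delta>" using \<rho>(2) x(2) by (auto simp: dist_norm norm_minus_commute)
      then have "norm (S x - S x0) \<le> L * norm (x - x0)" using lip x by auto
      moreover have "G (x - f x) - G (x0 - f x0) = (2 * C) *\<^sub>R (x - x0) - (S x - S x0)"
        by (simp add: S_def scaleR_diff_right)
      ultimately show ?thesis
        using norm_triangle_ineq4[of "(2 * C) *\<^sub>R (x - x0)" "S x - S x0"] C by (simp add: ring_distribs)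
    qed
    with \<open>0 < \<epsilon>\<close> \<rho>(1) show ?thesis by (intro exI[of _ "2 * C + L"] exI[of _ "min \<epsilon> \<rho>"]) auto
  qed
  then have "{x0 \<in> D \<inter> ball a \<delta>. \<not> ?P x0} \<subseteq> {x0 \<in> D \<inter> ball a \<delta>. \<not> (\<exists>C \<epsilon>. 0 < \<epsilon> \<and>
      (\<forall>x\<in>D \<inter> ball a \<delta>. norm (x - x0) < \<epsilon> \<longrightarrow> norm (S x - S x0) \<le> C * norm (x - x0)))}"
    by blast
  moreover have "negligible {x0 \<in> D \<inter> ball a \<delta>. \<not> (\<exists>C \<epsilon>. 0 < \<epsilon> \<and>
      (\<forall>x\<in>D \<inter> ball a \<delta>. norm (x - x0) < \<epsilon> \<longrightarrow> norm (S x - S x0) \<le> C * norm (x - x0)))}"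
    by (rule S.ae_pointwise_Lipschitz) simp
  ultimately have "negligible {x0 \<in> D \<inter> ball a \<delta>. \<not> ?P x0}" by (rule negligible_subset[rotated])
  with \<delta> show ?thesis by blast
qed

text \<open>Cauchy-Schwarz applied to \<open>gradient_uniform_mono\<close>: in effect the inverse of
  \<open>G\<close> is Hoelder continuous with exponent \<open>1 / (p - 1)\<close>.\<close>

lemma gradient_lower: "lam / 4 * (1 / 4) powr (p - 2) * norm (a - b) powr (p - 1) \<le> norm (G a - G b)"
proof (cases "a = b")
  case False
  then have n: "norm (a - b) > 0" by simp
  have "lam / 4 * (1 / 4) powr (p - 2) * norm (a - b) powr (p - 1) * norm (a - b)
      = lam / 4 * (1 / 4) powr (p - 2) * norm (a - b) powr p"
    using n by (simp add: powr_diff)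
  also have "\<dots> \<le> norm (G a - G b) * norm (a - b)"
    using gradient_uniform_mono[of a b] norm_cauchy_schwarz[of "G a - G b" "a - b"] by linarith
  finally show ?thesis using n by simp
qed simp

lemma h_monotone_Holder_at:
  assumes x0: "0 < \<epsilon>"
    "\<forall>x\<in>D. norm (x - x0) < \<epsilon> \<longrightarrow> norm (G (x - f x) - G (x0 - f x0)) \<le> L * norm (x - x0)"
  shows "\<exists>C \<delta>. \<delta> > 0 \<and> (\<forall>R. 0 < R \<and> R < \<delta> \<longrightarrow>
    (\<forall>x\<in>D \<inter> ball x0 R. norm (f x - f x0) \<le> C * R powr (1 / (p - 1))))"
proof -
  define c where "c = lam / 4 * (1 / 4) powr (p - 2)"
  have c: "c > 0" using lam_pos by (simp add: c_def)
  \<comment> \<open>The constant from solving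
    \<open>c * norm w powr (p - 1) \<le> \<bar>L\<bar> * R\<close> for
    \<open>norm w\<close>.\<close>
  define B where "B = (\<bar>L\<bar> / c) powr (1 / (p - 1))"
  have "norm (f x - f x0) \<le> (1 + B) * R powr (1 / (p - 1))"
    if R: "0 < R" "R < min \<epsilon> 1" and x: "x \<in> D" "x \<in> ball x0 R" for R x
  proof -
    have xR: "norm (x - x0) < R" using x by (simp add: dist_norm norm_minus_commute)
    define w where "w = (x - f x) - (x0 - f x0)"
    have "c * norm w powr (p - 1) \<le> L * norm (x - x0)"
      using gradient_lower[of "x - f x" "x0 - f x0"] x0(2)[rule_format, OF x(1)] xR R(2)
      by (simp add: c_def w_def)
    also have "\<dots> \<le> \<bar>L\<bar> * R" using xR by (intro mult_mono) auto
    finally have "norm w powr (p - 1) \<le> \<bar>L\<bar> / c * R" using c by (simp add: field_simps)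
    then have "(norm w powr (p - 1)) powr (1 / (p - 1)) \<le> (\<bar>L\<bar> / c * R) powr (1 / (p - 1))"
      using p by (intro powr_mono2) auto
    also have "(norm w powr (p - 1)) powr (1 / (p - 1)) = norm w"
      using p by (simp add: powr_powr)
    also have "(\<bar>L\<bar> / c * R) powr (1 / (p - 1)) = B * R powr (1 / (p - 1))"
      using c R powr_mult[of "\<bar>L\<bar> / c" R "1 / (p - 1)"] by (simp add: B_def)
    finally have "norm w \<le> B * R powr (1 / (p - 1))" .
    \<comment> \<open>As \<open>R < 1\<close> and the exponent is at most 1, the linear term
      \<open>x - x0\<close> is absorbed, which accounts for the 1 in \<open>1 + B\<close>.\<close>
    moreover have "R \<le> R powr (1 / (p - 1))"
      using powr_mono'[of "1 / (p - 1)" 1 R] p R by simp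
    moreover have "f x - f x0 = (x - x0) - w" by (simp add: w_def)
    ultimately show ?thesis
      using norm_triangle_ineq4[of "x - x0" w] xR by (simp add: ring_distribs)
  qed
  with x0(1) show ?thesis by (intro exI[of _ "1 + B"] exI[of _ "min \<epsilon> 1"]) auto
qed

theorem h_monotone_ae_Holder:
  assumes neg: "negligible (- D)"
    and mono: "\<And>x y. \<lbrakk>x \<in> D; y \<in> D\<rbrakk> \<Longrightarrow> h (x - f x) + h (y - f y) \<le> h (x - f y) + h (y - f x)"
  shows "AE x0 in lebesgue. \<exists>C \<delta>. \<delta> > 0 \<and> (\<forall>R. 0 < R \<and> R < \<delta> \<longrightarrow>
    (AE x in lebesgue. x \<in> ball x0 R \<longrightarrow> norm (f x - f x0) \<le> C * R powr (1 / (p - 1))))"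
proof -
  define P where "P x0 \<longleftrightarrow> (\<exists>C \<epsilon>. 0 < \<epsilon> \<and>
    (\<forall>x\<in>D. norm (x - x0) < \<epsilon> \<longrightarrow> norm (G (x - f x) - G (x0 - f x0)) \<le> C * norm (x - x0)))" for x0
  have AE_D: "AE x in lebesgue. x \<in> D"
    using neg by (intro AE_I'[of "- D"]) (auto simp: negligible_iff_null_sets)
  have "negligible {x0 \<in> D. \<not> P x0}"
    \<comment> \<open>The Lipschitz property was proved in a ball around each \<open>a\<close>
      separately; negligibility is a local property.\<close>
    unfolding locally_negligible_alt[of "{x0 \<in> D. \<not> P x0}"]
  proof
    fix a assume a: "a \<in> {x0 \<in> D. \<not> P x0}"
    obtain \<delta> where \<delta>: "\<delta> > 0" "negligible {x0 \<in> D \<inter> ball a \<delta>. \<not> P x0}"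
      using h_monotone_ae_pointwise_Lipschitz[OF dense_if_negligible_compl[OF neg] mono, of a]
      unfolding P_def by blast
    have "{x0 \<in> D \<inter> ball a \<delta>. \<not> P x0} = {x0 \<in> D. \<not> P x0} \<inter> ball a \<delta>" by auto
    with \<delta> a show "\<exists>U. openin (top_of_set {x0 \<in> D. \<not> P x0}) U \<and> a \<in> U \<and> negligible U"
      by (intro exI[of _ "{x0 \<in> D. \<not> P x0} \<inter> ball a \<delta>"]) (auto simp: openin_open)
  qed
  then have "AE x0 in lebesgue. x0 \<notin> {x0 \<in> D. \<not> P x0}"
    by (intro AE_not_in) (simp add: negligible_iff_null_sets)
  with AE_D have "AE x0 in lebesgue. P x0" by eventually_elim auto
  then show ?thesis
  proof eventually_elim
    case (elim x0)
    then obtain L \<epsilon> where "0 < \<epsilon>" "\<forall>x\<in>D. norm (x - x0) < \<epsilon> \<longrightarrow>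
        norm (G (x - f x) - G (x0 - f x0)) \<le> L * norm (x - x0)"
      unfolding P_def by blast
    from h_monotone_Holder_at[OF this] obtain C \<delta> where \<delta>: "\<delta> > 0"
      and C: "\<forall>R. 0 < R \<and> R < \<delta> \<longrightarrow>
        (\<forall>x\<in>D \<inter> ball x0 R. norm (f x - f x0) \<le> C * R powr (1 / (p - 1)))"
      by (elim exE conjE)
    have "AE x in lebesgue. x \<in> ball x0 R \<longrightarrow> norm (f x - f x0) \<le> C * R powr (1 / (p - 1))"
      if "0 < R" "R < \<delta>" for R
      using AE_D
    proof eventually_elim
      case (elim x)
      with C that show ?case by simp
    qed
    with \<delta> show ?case by blast
  qed
qed

end

theorem theorem5p5:
  fixes h :: "real^'n \<Rightarrow> real"
    and G :: "real^'n \<Rightarrow> real^'n"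
    and H :: "real^'n \<Rightarrow> real^'n^'n"
    and T :: "real^'n \<Rightarrow> (real^'n) set"
    and f :: "real^'n \<Rightarrow> real^'n"
    and p lam Lam :: real
  assumes p: "p \<ge> 2"
    and grad: "\<And>x. (h has_derivative (\<lambda>v. G x \<bullet> v)) (at x)"
    and hess: "\<And>x. (G has_derivative (\<lambda>v. H x *v v)) (at x)"
    and hess_cont: "continuous_on UNIV H"
    and nonneg: "\<And>x. h x \<ge> 0"
    and homog: "\<And>t x. t > 0 \<Longrightarrow> h (t *\<^sub>R x) = t powr p * h x"
    and ell: "0 < lam" "lam \<le> Lam"
    and ell_bounds: "\<And>x v. norm x = 1 \<Longrightarrow>
        lam * (norm v)\<^sup>2 \<le> v \<bullet> (H x *v v) \<and> v \<bullet> (H x *v v) \<le> Lam * (norm v)\<^sup>2"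
    and mono: "h_monotone h T"
    and T_ae: "AE x in lebesgue. T x = {f x}"
    and T_loc: "locally_Lq (p - 1) f"
  shows "AE x0 in lebesgue. \<exists>C \<delta>. \<delta> > 0 \<and>
           (\<forall>R. 0 < R \<and> R < \<delta> \<longrightarrow>
              (AE x in lebesgue. x \<in> ball x0 R \<longrightarrow>
                 norm (f x - f x0) \<le> C * R powr (1 / (p - 1))))"
proof -
  interpret elliptic_cost h G "\<lambda>x v. H x *v v" p lam Lam
  proof
    show "continuous_on UNIV (\<lambda>x. H x *v v)" for v
      unfolding matrix_vector_mult_def
      by (intro continuous_intros continuous_on_vec_lambda hess_cont)
  qed (use assms in auto)
  \<comment> \<open>On this set of full measure \<open>f x\<close> belongs to \<open>T x\<close>, so
    h-monotonicity of \<open>T\<close> becomes an inequality for the function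
    \<open>f\<close>.\<close>
  define D where "D = {x. T x = {f x}}"
  obtain N where "N \<in> null_sets lebesgue" "- D \<subseteq> N"
    using T_ae unfolding eventually_ae_filter D_def by auto
  then have "negligible (- D)"
    using negligible_iff_null_sets negligible_subset by blast
  moreover have "h (x - f x) + h (y - f y) \<le> h (x - f y) + h (y - f x)" if "x \<in> D" "y \<in> D" for x y
    using mono that unfolding h_monotone_def D_def by blast
  ultimately show ?thesis by (rule h_monotone_ae_Holder)
qed

end
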